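(* Let $G$ be a $\overline{C}$-group. Then the group homomorphism $$\pi\times \mathrm{Ab}\colon A(G)\to G\times \mathbb{Z}^{\mathfrak{C}(G)},\qquad g\mapsto (\pi(g),\mathrm{Ab}(g)),$$ is injective.
   Context: For a group $G$, the structure group of its conjugation quandle is $A(G)=\langle e_a,\ a\in G \mid e_ae_b=e_b e_{b^{-1}ab},\ a,b\in G\rangle$. The set of conjugacy classes of $G$ is $\mathfrak{C}(G)$. For a set $X$, $\mathbb{Z}^{X}$ denotes the free abelian group with basis $(c_x)_{x\in X}$ (direct sum). The homomorphism $\pi\colon A(G)\to G$ is defined by $e_a\mapsto a$, and $\mathrm{Ab}\colon A(G)\to\mathbb{Z}^{\mathfrak{C}(G)}$ (the abelianisation map) by $e_a\mapsto c_{\mathcal{O}}$, where $\mathcal{O}$ is the conjugacy class of $a$. A $\overline{C}$-group is a group $G$ admitting a presentation (a $\overline{C}$-type presentation), with some generator set $\Gamma$, in which every relation is either a conjugation relation $b^{-1}ab=c$ with $a,b,c\in\Gamma$, or a power relation $a^k=1$ with $a\in\Gamma$, $k\ge 2$; there is at most one power relation per conjugacy class of $G$ (i.e., for each conjugacy class $\mathcal{O}$ of $G$, at most one power relation $a^k=1$ has $a\in\mathcal{O}$). *)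

theory Defs
  imports "HOL-Algebra.Free_Abelian_Groups" "HOL-Algebra.Group_Action"
begin

section \<open>Groups given by generators and relations\<close>

text \<open>
  A word over \<open>\<Gamma>\<close> is a list of signed letters: \<open>(x, True)\<close> stands for \<open>x\<close> and
  \<open>(x, False)\<close> for \<open>x\<inverse>\<close>. A relation \<open>u = v\<close> is the pair \<open>(u, v)\<close> of words.
\<close>

type_synonym 'x word = "('x \<times> bool) list"

definition words :: "'x set \<Rightarrow> 'x word set"
  where "words \<Gamma> = lists (\<Gamma> \<times> UNIV)"

inductive_set pres_cong :: "'x set \<Rightarrow> ('x word \<times> 'x word) set \<Rightarrow> ('x word \<times> 'x word) set"
  for \<Gamma> :: "'x set" and R :: "('x word \<times> 'x word) set"
where
  refl: "w \<in> words \<Gamma> \<Longrightarrow> (w, w) \<in> pres_cong \<Gamma> R"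
| sym: "(u, v) \<in> pres_cong \<Gamma> R \<Longrightarrow> (v, u) \<in> pres_cong \<Gamma> R"
| trans: "(u, v) \<in> pres_cong \<Gamma> R \<Longrightarrow> (v, w) \<in> pres_cong \<Gamma> R \<Longrightarrow> (u, w) \<in> pres_cong \<Gamma> R"
| app: "(u, u') \<in> pres_cong \<Gamma> R \<Longrightarrow> (v, v') \<in> pres_cong \<Gamma> R \<Longrightarrow> (u @ v, u' @ v') \<in> pres_cong \<Gamma> R"
| cancel: "x \<in> \<Gamma> \<Longrightarrow> ([(x, s), (x, \<not> s)], []) \<in> pres_cong \<Gamma> R"
| rel: "(u, v) \<in> R \<Longrightarrow> u \<in> words \<Gamma> \<Longrightarrow> v \<in> words \<Gamma> \<Longrightarrow> (u, v) \<in> pres_cong \<Gamma> R"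

definition presented_group :: "'x set \<Rightarrow> ('x word \<times> 'x word) set \<Rightarrow> 'x word set monoid"
  where "presented_group \<Gamma> R =
    \<lparr>carrier = words \<Gamma> // pres_cong \<Gamma> R,
     monoid.mult = (\<lambda>S T. \<Union>u\<in>S. \<Union>v\<in>T. pres_cong \<Gamma> R `` {u @ v}),
     one = pres_cong \<Gamma> R `` {[]}\<rparr>"

definition pres_gen :: "'x set \<Rightarrow> ('x word \<times> 'x word) set \<Rightarrow> 'x \<Rightarrow> 'x word set"
  where "pres_gen \<Gamma> R x = pres_cong \<Gamma> R `` {[(x, True)]}"

definition word_eval :: "('h, 'm) monoid_scheme \<Rightarrow> ('x \<Rightarrow> 'h) \<Rightarrow> 'x word \<Rightarrow> 'h"
  where "word_eval H f w =
    foldr (\<lambda>(x, s) y. (if s then f x else inv\<^bsub>H\<^esub> (f x)) \<otimes>\<^bsub>H\<^esub> y) w \<one>\<^bsub>H\<^esub>"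

text \<open>
  The homomorphism out of a presented group determined by images \<open>f\<close> of the generators.
  The choice of the representative is immaterial as soon as \<open>f\<close> respects the relations;
  see \<open>pres_lift_class\<close>, \<open>pres_lift_hom\<close>, \<open>pres_lift_gen\<close> and \<open>pres_hom_unique\<close>.
\<close>

definition pres_lift :: "('h, 'm) monoid_scheme \<Rightarrow> ('x \<Rightarrow> 'h) \<Rightarrow> 'x word set \<Rightarrow> 'h"
  where "pres_lift H f S = word_eval H f (SOME w. w \<in> S)"

subsection \<open>Basic facts\<close>

lemma words_Nil [simp]: "[] \<in> words \<Gamma>"
  and words_Cons [simp]: "p # w \<in> words \<Gamma> \<longleftrightarrow> fst p \<in> \<Gamma> \<and> w \<in> words \<Gamma>"
  and words_append [simp]: "u @ v \<in> words \<Gamma> \<longleftrightarrow> u \<in> words \<Gamma> \<and> v \<in> words \<Gamma>"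
  by (auto simp: words_def mem_Times_iff)

lemma pres_cong_words: "(u, v) \<in> pres_cong \<Gamma> R \<Longrightarrow> u \<in> words \<Gamma> \<and> v \<in> words \<Gamma>"
  by (induction rule: pres_cong.induct) auto

lemma equiv_pres_cong: "equiv (words \<Gamma>) (pres_cong \<Gamma> R)"
proof (rule equivI)
  show "pres_cong \<Gamma> R \<subseteq> words \<Gamma> \<times> words \<Gamma>"
    by (auto dest: pres_cong_words)
  show "refl_on (words \<Gamma>) (pres_cong \<Gamma> R)"
    by (auto simp: refl_on_def intro: pres_cong.refl)
  show "sym (pres_cong \<Gamma> R)"
    by (rule symI) (rule pres_cong.sym)
  show "trans (pres_cong \<Gamma> R)"
    by (rule transI) (rule pres_cong.trans)
qed

lemma pres_class_eq:
  "u \<in> words \<Gamma> \<Longrightarrow> v \<in> words \<Gamma> \<Longrightarrow>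
    pres_cong \<Gamma> R `` {u} = pres_cong \<Gamma> R `` {v} \<longleftrightarrow> (u, v) \<in> pres_cong \<Gamma> R"
  using eq_equiv_class_iff[OF equiv_pres_cong] by metis

lemma pres_mult_class:
  assumes "u \<in> words \<Gamma>" "v \<in> words \<Gamma>"
  shows "(pres_cong \<Gamma> R `` {u}) \<otimes>\<^bsub>presented_group \<Gamma> R\<^esub> (pres_cong \<Gamma> R `` {v})
    = pres_cong \<Gamma> R `` {u @ v}"
proof -
  have eq: "pres_cong \<Gamma> R `` {u' @ v'} = pres_cong \<Gamma> R `` {u @ v}"
    if "(u, u') \<in> pres_cong \<Gamma> R" "(v, v') \<in> pres_cong \<Gamma> R" for u' v'
    using that pres_cong_words[OF that(1)] pres_cong_words[OF that(2)]
      pres_cong.sym[OF pres_cong.app[OF that]]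
    by (simp add: pres_class_eq)
  have mem: "u \<in> pres_cong \<Gamma> R `` {u}" "v \<in> pres_cong \<Gamma> R `` {v}"
    using assms by (simp_all add: pres_cong.refl)
  have "(\<Union>u'\<in>pres_cong \<Gamma> R `` {u}. \<Union>v'\<in>pres_cong \<Gamma> R `` {v}. pres_cong \<Gamma> R `` {u' @ v'})
      = (\<Union>u'\<in>pres_cong \<Gamma> R `` {u}. \<Union>v'\<in>pres_cong \<Gamma> R `` {v}. pres_cong \<Gamma> R `` {u @ v})"
    by (intro SUP_cong refl eq) auto
  also have "\<dots> = pres_cong \<Gamma> R `` {u @ v}"
    using mem by blast
  finally show ?thesis
    by (simp add: presented_group_def)
qed

lemma pres_carrier_iff:
  "S \<in> carrier (presented_group \<Gamma> R) \<longleftrightarrow> (\<exists>w \<in> words \<Gamma>. S = pres_cong \<Gamma> R `` {w})"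
  by (auto simp: presented_group_def quotient_def)

lemma pres_one: "\<one>\<^bsub>presented_group \<Gamma> R\<^esub> = pres_cong \<Gamma> R `` {[]}"
  by (simp add: presented_group_def)

lemma pres_left_inverse:
  assumes "w \<in> words \<Gamma>"
  shows "\<exists>v \<in> words \<Gamma>. (v @ w, []) \<in> pres_cong \<Gamma> R"
  using assms
proof (induction w)
  case Nil
  have "([] @ [], []) \<in> pres_cong \<Gamma> R" by (simp add: pres_cong.refl)
  then show ?case using words_Nil by blast
next
  case (Cons p w)
  obtain x s where p: "p = (x, s)" by force
  with Cons obtain v where v: "v \<in> words \<Gamma>" "(v @ w, []) \<in> pres_cong \<Gamma> R" by auto
  have x: "x \<in> \<Gamma>" and w: "w \<in> words \<Gamma>" using Cons.prems p by auto
  have "([(x, \<not> s), (x, s)], []) \<in> pres_cong \<Gamma> R"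
    using pres_cong.cancel[OF x, of "\<not> s"] by simp
  then have "([(x, \<not> s), (x, s)] @ w, [] @ w) \<in> pres_cong \<Gamma> R"
    by (rule pres_cong.app) (rule pres_cong.refl[OF w])
  then have "(v @ [(x, \<not> s), (x, s)] @ w, v @ [] @ w) \<in> pres_cong \<Gamma> R"
    by (rule pres_cong.app[OF pres_cong.refl[OF v(1)]])
  then have "((v @ [(x, \<not> s)]) @ p # w, []) \<in> pres_cong \<Gamma> R"
    using pres_cong.trans[OF _ v(2)] p by simp
  then show ?case using v(1) x by (intro bexI[of _ "v @ [(x, \<not> s)]"]) auto
qed

lemma group_presented_group: "group (presented_group \<Gamma> R)"
proof (rule groupI)
  fix S assume "S \<in> carrier (presented_group \<Gamma> R)"
  then obtain w where w: "w \<in> words \<Gamma>" "S = pres_cong \<Gamma> R `` {w}" by (auto simp: pres_carrier_iff)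
  obtain v where v: "v \<in> words \<Gamma>" "(v @ w, []) \<in> pres_cong \<Gamma> R"
    using pres_left_inverse[OF w(1)] by blast
  have "(pres_cong \<Gamma> R `` {v}) \<otimes>\<^bsub>presented_group \<Gamma> R\<^esub> S = \<one>\<^bsub>presented_group \<Gamma> R\<^esub>"
    using v w by (simp add: pres_mult_class pres_one pres_class_eq)
  then show "\<exists>T\<in>carrier (presented_group \<Gamma> R). T \<otimes>\<^bsub>presented_group \<Gamma> R\<^esub> S = \<one>\<^bsub>presented_group \<Gamma> R\<^esub>"
    using v(1) by (intro bexI[of _ "pres_cong \<Gamma> R `` {v}"]) (auto simp: pres_carrier_iff)
next
  fix S T assume "S \<in> carrier (presented_group \<Gamma> R)" "T \<in> carrier (presented_group \<Gamma> R)"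
  then obtain u v where "u \<in> words \<Gamma>" "S = pres_cong \<Gamma> R `` {u}" "v \<in> words \<Gamma>" "T = pres_cong \<Gamma> R `` {v}"
    by (auto simp: pres_carrier_iff)
  then show "S \<otimes>\<^bsub>presented_group \<Gamma> R\<^esub> T \<in> carrier (presented_group \<Gamma> R)"
    unfolding pres_carrier_iff by (intro bexI[of _ "u @ v"]) (simp_all add: pres_mult_class)
next
  show "\<one>\<^bsub>presented_group \<Gamma> R\<^esub> \<in> carrier (presented_group \<Gamma> R)"
    unfolding pres_carrier_iff pres_one by (intro bexI[of _ "[]"]) simp_all
next
  fix S T U assume "S \<in> carrier (presented_group \<Gamma> R)" "T \<in> carrier (presented_group \<Gamma> R)"
    "U \<in> carrier (presented_group \<Gamma> R)"
  then obtain u v w where "u \<in> words \<Gamma>" "S = pres_cong \<Gamma> R `` {u}"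
    "v \<in> words \<Gamma>" "T = pres_cong \<Gamma> R `` {v}" "w \<in> words \<Gamma>" "U = pres_cong \<Gamma> R `` {w}"
    unfolding pres_carrier_iff by metis
  then show "S \<otimes>\<^bsub>presented_group \<Gamma> R\<^esub> T \<otimes>\<^bsub>presented_group \<Gamma> R\<^esub> U
      = S \<otimes>\<^bsub>presented_group \<Gamma> R\<^esub> (T \<otimes>\<^bsub>presented_group \<Gamma> R\<^esub> U)"
    by (simp add: pres_mult_class)
next
  fix S assume "S \<in> carrier (presented_group \<Gamma> R)"
  then obtain u where "u \<in> words \<Gamma>" "S = pres_cong \<Gamma> R `` {u}"
    unfolding pres_carrier_iff by metis
  then show "\<one>\<^bsub>presented_group \<Gamma> R\<^esub> \<otimes>\<^bsub>presented_group \<Gamma> R\<^esub> S = S"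
    by (simp add: pres_mult_class pres_one)
qed

lemma pres_gen_closed: "x \<in> \<Gamma> \<Longrightarrow> pres_gen \<Gamma> R x \<in> carrier (presented_group \<Gamma> R)"
  by (auto simp: pres_gen_def pres_carrier_iff intro!: bexI[of _ "[(x, True)]"])

lemma word_eval_simps [simp]:
  "word_eval H f [] = \<one>\<^bsub>H\<^esub>"
  "word_eval H f ((x, s) # w) = (if s then f x else inv\<^bsub>H\<^esub> (f x)) \<otimes>\<^bsub>H\<^esub> word_eval H f w"
  by (simp_all add: word_eval_def)

context group
begin

lemma word_eval_closed:
  assumes "f \<in> \<Gamma> \<rightarrow> carrier G" "w \<in> words \<Gamma>"
  shows "word_eval G f w \<in> carrier G"
  using assms(2)
proof (induction w)
  case (Cons p w)
  then show ?case using assms(1) by (cases p) auto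
qed simp

lemma word_eval_append:
  assumes "f \<in> \<Gamma> \<rightarrow> carrier G" "u \<in> words \<Gamma>" "v \<in> words \<Gamma>"
  shows "word_eval G f (u @ v) = word_eval G f u \<otimes> word_eval G f v"
  using assms(2)
proof (induction u)
  case Nil
  then show ?case using word_eval_closed[OF assms(1,3)] by simp
next
  case (Cons p u)
  obtain x s where p: "p = (x, s)" by force
  have "f x \<in> carrier G" using assms(1) Cons.prems p by auto
  then show ?case
    using Cons word_eval_closed[OF assms(1), of u] word_eval_closed[OF assms(1,3)]
    by (auto simp: p m_assoc)
qed

lemma word_eval_cong:
  assumes f: "f \<in> \<Gamma> \<rightarrow> carrier G"
    and R: "\<And>u v. (u, v) \<in> R \<Longrightarrow> u \<in> words \<Gamma> \<Longrightarrow> v \<in> words \<Gamma> \<Longrightarrow> word_eval G f u = word_eval G f v"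
    and "(u, v) \<in> pres_cong \<Gamma> R"
  shows "word_eval G f u = word_eval G f v"
  using assms(3)
proof (induction rule: pres_cong.induct)
  case (app u u' v v')
  then show ?case
    using pres_cong_words[OF app.hyps(1)] pres_cong_words[OF app.hyps(2)]
    by (simp add: word_eval_append[OF f])
next
  case (cancel x s)
  then have "f x \<in> carrier G" using f by auto
  then show ?case by simp
qed (use R in auto)

lemma pres_lift_class:
  assumes f: "f \<in> \<Gamma> \<rightarrow> carrier G"
    and R: "\<And>u v. (u, v) \<in> R \<Longrightarrow> u \<in> words \<Gamma> \<Longrightarrow> v \<in> words \<Gamma> \<Longrightarrow> word_eval G f u = word_eval G f v"
    and w: "w \<in> words \<Gamma>"
  shows "pres_lift G f (pres_cong \<Gamma> R `` {w}) = word_eval G f w"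
proof -
  have "w \<in> pres_cong \<Gamma> R `` {w}" using w by (auto intro: pres_cong.refl)
  then have "(SOME v. v \<in> pres_cong \<Gamma> R `` {w}) \<in> pres_cong \<Gamma> R `` {w}" by (rule someI)
  then have "(w, SOME v. v \<in> pres_cong \<Gamma> R `` {w}) \<in> pres_cong \<Gamma> R" by blast
  from word_eval_cong[OF f R this] show ?thesis by (simp add: pres_lift_def)
qed

lemma pres_lift_hom:
  assumes f: "f \<in> \<Gamma> \<rightarrow> carrier G"
    and R: "\<And>u v. (u, v) \<in> R \<Longrightarrow> u \<in> words \<Gamma> \<Longrightarrow> v \<in> words \<Gamma> \<Longrightarrow> word_eval G f u = word_eval G f v"
  shows "pres_lift G f \<in> hom (presented_group \<Gamma> R) G"
proof (rule homI)
  fix S assume "S \<in> carrier (presented_group \<Gamma> R)"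
  then show "pres_lift G f S \<in> carrier G"
    using pres_lift_class[OF f R] word_eval_closed[OF f] by (auto simp: pres_carrier_iff)
next
  fix S T assume "S \<in> carrier (presented_group \<Gamma> R)" "T \<in> carrier (presented_group \<Gamma> R)"
  then obtain u v where uv: "u \<in> words \<Gamma>" "v \<in> words \<Gamma>"
    and S: "S = pres_cong \<Gamma> R `` {u}" and T: "T = pres_cong \<Gamma> R `` {v}"
    by (auto simp: pres_carrier_iff)
  have "pres_lift G f (pres_cong \<Gamma> R `` {u @ v}) = word_eval G f (u @ v)"
    using uv by (intro pres_lift_class[OF f R]) auto
  then show "pres_lift G f (S \<otimes>\<^bsub>presented_group \<Gamma> R\<^esub> T) = pres_lift G f S \<otimes> pres_lift G f T"
    using uv pres_lift_class[OF f R uv(1)] pres_lift_class[OF f R uv(2)]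
    by (simp add: S T pres_mult_class word_eval_append[OF f])
qed

lemma pres_lift_gen:
  assumes f: "f \<in> \<Gamma> \<rightarrow> carrier G"
    and R: "\<And>u v. (u, v) \<in> R \<Longrightarrow> u \<in> words \<Gamma> \<Longrightarrow> v \<in> words \<Gamma> \<Longrightarrow> word_eval G f u = word_eval G f v"
    and x: "x \<in> \<Gamma>"
  shows "pres_lift G f (pres_gen \<Gamma> R x) = f x"
proof -
  have "pres_lift G f (pres_cong \<Gamma> R `` {[(x, True)]}) = word_eval G f [(x, True)]"
    using x by (intro pres_lift_class[OF f R]) auto
  moreover have "f x \<in> carrier G" using f x by auto
  ultimately show ?thesis by (simp add: pres_gen_def)
qed

lemma pres_hom_class:
  assumes h: "h \<in> hom (presented_group \<Gamma> R) G" and w: "w \<in> words \<Gamma>"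
  shows "h (pres_cong \<Gamma> R `` {w}) = word_eval G (\<lambda>x. h (pres_gen \<Gamma> R x)) w"
proof -
  interpret H: group_hom "presented_group \<Gamma> R" G h
    using h group_presented_group is_group by (simp add: group_hom_def group_hom_axioms_def)
  show ?thesis using w
  proof (induction w)
    case Nil
    then show ?case using H.hom_one by (simp add: pres_one)
  next
    case (Cons p w)
    obtain x s where p: "p = (x, s)" by force
    have x: "x \<in> \<Gamma>" and w: "w \<in> words \<Gamma>" using Cons.prems p by auto
    have "(pres_cong \<Gamma> R `` {[(x, False)]}) \<otimes>\<^bsub>presented_group \<Gamma> R\<^esub> pres_gen \<Gamma> R x
        = \<one>\<^bsub>presented_group \<Gamma> R\<^esub>"
      using x pres_cong.cancel[OF x, of False R]
      by (simp add: pres_gen_def pres_mult_class pres_one pres_class_eq)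
    moreover have letter: "pres_cong \<Gamma> R `` {[(x, s)]} \<in> carrier (presented_group \<Gamma> R)" for s
      using x by (auto simp: pres_carrier_iff intro!: bexI[of _ "[(x, s)]"])
    ultimately have "pres_cong \<Gamma> R `` {[(x, False)]} = inv\<^bsub>presented_group \<Gamma> R\<^esub> pres_gen \<Gamma> R x"
      using pres_gen_closed[OF x] by (metis H.G.inv_equality)
    then have "h (pres_cong \<Gamma> R `` {[(x, s)]})
        = (if s then h (pres_gen \<Gamma> R x) else inv (h (pres_gen \<Gamma> R x)))"
      using pres_gen_closed[OF x] by (simp add: pres_gen_def)
    moreover have "pres_cong \<Gamma> R `` {p # w}
        = (pres_cong \<Gamma> R `` {[(x, s)]}) \<otimes>\<^bsub>presented_group \<Gamma> R\<^esub> (pres_cong \<Gamma> R `` {w})"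
      using x w by (simp add: pres_mult_class p)
    moreover have "pres_cong \<Gamma> R `` {w} \<in> carrier (presented_group \<Gamma> R)"
      using w by (auto simp: pres_carrier_iff)
    ultimately show ?case
      using Cons.IH[OF w] letter[of s] by (simp add: p H.hom_mult)
  qed
qed

lemma pres_hom_unique:
  assumes "h \<in> hom (presented_group \<Gamma> R) G" "h' \<in> hom (presented_group \<Gamma> R) G"
    and eq: "\<And>x. x \<in> \<Gamma> \<Longrightarrow> h (pres_gen \<Gamma> R x) = h' (pres_gen \<Gamma> R x)"
    and "S \<in> carrier (presented_group \<Gamma> R)"
  shows "h S = h' S"
proof -
  obtain w where w: "w \<in> words \<Gamma>" and S: "S = pres_cong \<Gamma> R `` {w}"
    using assms(4) by (auto simp: pres_carrier_iff)
  have "word_eval G (\<lambda>x. h (pres_gen \<Gamma> R x)) w = word_eval G (\<lambda>x. h' (pres_gen \<Gamma> R x)) w"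
    using w by (induction w) (auto simp: eq)
  then show ?thesis
    using pres_hom_class[OF assms(1) w] pres_hom_class[OF assms(2) w] by (simp add: S)
qed

end

section \<open>Conjugacy classes\<close>

definition conj_class :: "('a, 'm) monoid_scheme \<Rightarrow> 'a \<Rightarrow> 'a set"
  where "conj_class G a =
    orbit G (\<lambda>g. \<lambda>h \<in> carrier G. g \<otimes>\<^bsub>G\<^esub> h \<otimes>\<^bsub>G\<^esub> inv\<^bsub>G\<^esub> g) a"

definition conj_classes :: "('a, 'm) monoid_scheme \<Rightarrow> 'a set set"
  where "conj_classes G =
    orbits G (carrier G) (\<lambda>g. \<lambda>h \<in> carrier G. g \<otimes>\<^bsub>G\<^esub> h \<otimes>\<^bsub>G\<^esub> inv\<^bsub>G\<^esub> g)"

lemma conj_class_in_conj_classes: "a \<in> carrier G \<Longrightarrow> conj_class G a \<in> conj_classes G"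
  by (auto simp: conj_class_def conj_classes_def orbits_def)

lemma (in group) conj_class_conj:
  assumes "a \<in> carrier G" "b \<in> carrier G"
  shows "conj_class G (inv b \<otimes> a \<otimes> b) = conj_class G a"
proof -
  let ?\<phi> = "\<lambda>g. \<lambda>h \<in> carrier G. g \<otimes> h \<otimes> inv g"
  interpret A: group_action G "carrier G" ?\<phi> by (rule action_by_conjugation)
  let ?c = "inv b \<otimes> a \<otimes> b"
  have c: "?c \<in> carrier G" using assms by simp
  have "?c = ?\<phi> (inv b) a" using assms by simp
  then have ca: "?c \<in> orbit G ?\<phi> a"
    using assms unfolding orbit_def by blast
  then have ac: "a \<in> orbit G ?\<phi> ?c"
    using A.orbit_sym[OF assms(1) c] by blast
  have sub: "orbit G ?\<phi> x \<subseteq> carrier G" if "x \<in> carrier G" for x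
    using that by (auto simp: orbit_def)
  show ?thesis unfolding conj_class_def
    using A.orbit_trans[OF assms(1) c _ ca] A.orbit_trans[OF c assms(1) _ ac]
      sub[OF assms(1)] sub[OF c] by blast
qed

section \<open>The structure group of the conjugation quandle\<close>

definition quandle_rels :: "('a, 'm) monoid_scheme \<Rightarrow> ('a word \<times> 'a word) set"
  where "quandle_rels G =
    {([(a, True), (b, True)], [(b, True), (inv\<^bsub>G\<^esub> b \<otimes>\<^bsub>G\<^esub> a \<otimes>\<^bsub>G\<^esub> b, True)]) | a b.
      a \<in> carrier G \<and> b \<in> carrier G}"

definition structure_group :: "('a, 'm) monoid_scheme \<Rightarrow> 'a word set monoid"
  where "structure_group G = presented_group (carrier G) (quandle_rels G)"

definition structure_gen :: "('a, 'm) monoid_scheme \<Rightarrow> 'a \<Rightarrow> 'a word set"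
  where "structure_gen G a = pres_gen (carrier G) (quandle_rels G) a"

definition proj_hom :: "('a, 'm) monoid_scheme \<Rightarrow> 'a word set \<Rightarrow> 'a"
  where "proj_hom G = pres_lift G (\<lambda>a. a)"

definition ab_hom :: "('a, 'm) monoid_scheme \<Rightarrow> 'a word set \<Rightarrow> ('a set \<Rightarrow>\<^sub>0 int)"
  where "ab_hom G = pres_lift (free_Abelian_group (conj_classes G)) (\<lambda>a. frag_of (conj_class G a))"

context group
begin

lemma proj_hom_respects:
  assumes "(u, v) \<in> quandle_rels G"
  shows "word_eval G (\<lambda>a. a) u = word_eval G (\<lambda>a. a) v"
proof -
  obtain a b where ab: "a \<in> carrier G" "b \<in> carrier G"
    and u: "u = [(a, True), (b, True)]" and v: "v = [(b, True), (inv b \<otimes> a \<otimes> b, True)]"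
    using assms unfolding quandle_rels_def by blast
  have "b \<otimes> (inv b \<otimes> a \<otimes> b) = a \<otimes> b"
    using ab by (metis inv_closed inv_solve_left m_assoc m_closed)
  then show ?thesis using ab by (simp add: u v)
qed

lemma proj_hom_hom: "proj_hom G \<in> hom (structure_group G) G"
  unfolding proj_hom_def structure_group_def by (rule pres_lift_hom) (auto intro: proj_hom_respects)

lemma proj_hom_gen: "a \<in> carrier G \<Longrightarrow> proj_hom G (structure_gen G a) = a"
  unfolding proj_hom_def structure_gen_def
  by (rule pres_lift_gen) (auto intro: proj_hom_respects)

lemma ab_hom_respects:
  assumes "(u, v) \<in> quandle_rels G"
  shows "word_eval (free_Abelian_group (conj_classes G)) (\<lambda>a. frag_of (conj_class G a)) u
    = word_eval (free_Abelian_group (conj_classes G)) (\<lambda>a. frag_of (conj_class G a)) v"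
proof -
  obtain a b where ab: "a \<in> carrier G" "b \<in> carrier G"
    and u: "u = [(a, True), (b, True)]" and v: "v = [(b, True), (inv b \<otimes> a \<otimes> b, True)]"
    using assms unfolding quandle_rels_def by blast
  then show ?thesis by (simp add: conj_class_conj add.commute)
qed

lemma ab_hom_hom: "ab_hom G \<in> hom (structure_group G) (free_Abelian_group (conj_classes G))"
  unfolding ab_hom_def structure_group_def
  by (rule group.pres_lift_hom[OF group_free_Abelian_group])
    (auto intro: ab_hom_respects simp: conj_class_in_conj_classes)

lemma ab_hom_gen:
  "a \<in> carrier G \<Longrightarrow> ab_hom G (structure_gen G a) = frag_of (conj_class G a)"
  unfolding ab_hom_def structure_gen_def
  by (rule group.pres_lift_gen[OF group_free_Abelian_group])
    (auto intro: ab_hom_respects simp: conj_class_in_conj_classes)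

end

section \<open>$\overline{C}$-groups\<close>

text \<open>
  A triple \<open>(a, b, c) \<in> C\<close> encodes the relation \<open>b\<inverse> a b = c\<close>, a pair \<open>(a, k) \<in> P\<close> the
  relation \<open>a\<^sup>k = 1\<close>.
\<close>

definition Cbar_rels :: "('x \<times> 'x \<times> 'x) set \<Rightarrow> ('x \<times> nat) set \<Rightarrow> ('x word \<times> 'x word) set"
  where "Cbar_rels C P =
    {([(b, False), (a, True), (b, True)], [(c, True)]) | a b c. (a, b, c) \<in> C} \<union>
    {(replicate k (a, True), []) | a k. (a, k) \<in> P}"

text \<open>
  The isomorphism \<open>h\<close> identifies the presented group with \<open>G\<close>; the conjugacy class of \<open>G\<close>
  containing a generator \<open>a\<close> is the class of its image. Distinct generators are allowed to
  have the same image in \<open>G\<close>.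
\<close>

definition Cbar_presentation ::
  "('a, 'm) monoid_scheme \<Rightarrow> 'x set \<Rightarrow> ('x \<times> 'x \<times> 'x) set \<Rightarrow> ('x \<times> nat) set \<Rightarrow> ('x word set \<Rightarrow> 'a) \<Rightarrow> bool"
  where "Cbar_presentation G \<Gamma> C P h \<longleftrightarrow>
    C \<subseteq> \<Gamma> \<times> \<Gamma> \<times> \<Gamma> \<and>
    P \<subseteq> \<Gamma> \<times> {2..} \<and>
    h \<in> iso (presented_group \<Gamma> (Cbar_rels C P)) G \<and>
    (\<forall>\<O> \<in> conj_classes G. \<forall>(a, k) \<in> P. \<forall>(b, l) \<in> P.
      h (pres_gen \<Gamma> (Cbar_rels C P) a) \<in> \<O> \<longrightarrow>
      h (pres_gen \<Gamma> (Cbar_rels C P) b) \<in> \<O> \<longrightarrow> (a, k) = (b, l))"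

text \<open>
  The generators are drawn from the type \<open>'x\<close>. HOL cannot quantify over it inside the
  definition, so it is a parameter, left arbitrary wherever the predicate is a hypothesis.
\<close>

definition Cbar_group :: "'x itself \<Rightarrow> ('a, 'm) monoid_scheme \<Rightarrow> bool"
  where "Cbar_group (_ :: 'x itself) G \<longleftrightarrow>
    group G \<and>
    (\<exists>(\<Gamma> :: 'x set) C P h. Cbar_presentation G \<Gamma> C P h)"

end

theory Submission
  imports Defs
begin

text \<open>
  Since \<open>g e\<^sub>a g\<inverse> = e\<^sub>b\<close> with \<open>b = \<pi>(g) a \<pi>(g)\<inverse>\<close>, the kernel of \<open>\<pi>\<close> is central in \<open>A(G)\<close>. Let \<open>Z\<close> be
  the central subgroup generated by the \<open>e\<^sub>a\<^sup>k\<close> over all power relations \<open>a\<^sup>k = 1\<close>. The relations of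
  the presentation hold for the cosets \<open>Z e\<^sub>a\<close>, which gives a homomorphism \<open>s : G \<rightarrow> A(G)/Z\<close> that is
  a section of the map induced by \<open>\<pi>\<close>. The homomorphisms \<open>g \<mapsto> Z g\<close> and \<open>g \<mapsto> s(\<pi>(g))\<close> differ by
  central factors, so they agree on commutators, hence on the derived subgroup, which is the kernel
  of \<open>Ab\<close>. A \<open>g\<close> in both kernels therefore satisfies \<open>Z g = s(1) = Z\<close>, that is \<open>g \<in> Z\<close>. Finally
  \<open>Ab\<close> is injective on \<open>Z\<close>, because \<open>Ab(e\<^sub>a\<^sup>k)\<close> is \<open>k\<close> times the class of \<open>a\<close> and distinct power
  relations belong to distinct classes.
\<close>

section \<open>Homomorphisms that agree modulo the center\<close>

definition center :: "('a, 'm) monoid_scheme \<Rightarrow> 'a set"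
  where "center G = {z \<in> carrier G. \<forall>g \<in> carrier G. z \<otimes>\<^bsub>G\<^esub> g = g \<otimes>\<^bsub>G\<^esub> z}"

lemma centerI:
  assumes "z \<in> carrier G" "\<And>g. g \<in> carrier G \<Longrightarrow> z \<otimes>\<^bsub>G\<^esub> g = g \<otimes>\<^bsub>G\<^esub> z"
  shows "z \<in> center G"
  using assms unfolding center_def by blast

lemma center_closed [simp]: "z \<in> center G \<Longrightarrow> z \<in> carrier G"
  unfolding center_def by blast

lemma center_commute: "z \<in> center G \<Longrightarrow> g \<in> carrier G \<Longrightarrow> z \<otimes>\<^bsub>G\<^esub> g = g \<otimes>\<^bsub>G\<^esub> z"
  unfolding center_def by blast

context group
begin

lemma inv_mult_cancel:
  assumes "x \<in> carrier G" "y \<in> carrier G"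
  shows "inv x \<otimes> (x \<otimes> y) = y" "x \<otimes> (inv x \<otimes> y) = y"
  using assms by (simp_all flip: m_assoc)

lemma subgroup_center: "subgroup (center G) G"
proof
  fix x y assume xy: "x \<in> center G" "y \<in> center G"
  show "x \<otimes> y \<in> center G"
  proof (rule centerI)
    fix g assume g: "g \<in> carrier G"
    have "x \<otimes> y \<otimes> g = x \<otimes> (g \<otimes> y)"
      using xy g by (simp add: m_assoc center_commute[of y])
    also have "\<dots> = g \<otimes> x \<otimes> y"
      using xy g by (simp add: center_commute[of x G g] flip: m_assoc)
    finally show "x \<otimes> y \<otimes> g = g \<otimes> (x \<otimes> y)"
      using xy g by (simp add: m_assoc)
  qed (use xy in simp)
next
  fix x assume x: "x \<in> center G"
  show "inv x \<in> center G"
  proof (rule centerI)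
    fix g assume g: "g \<in> carrier G"
    have "x \<otimes> (g \<otimes> inv x) = g"
      using x g by (simp add: center_commute[of x] m_assoc)
    then show "inv x \<otimes> g = g \<otimes> inv x"
      using x g by (simp add: inv_solve_left')
  qed (use x in simp)
qed (auto intro: centerI)

lemma conj_mult_center:
  assumes "x \<in> carrier G" "y \<in> carrier G" "z \<in> center G"
  shows "x \<otimes> z \<otimes> y \<otimes> inv (x \<otimes> z) = x \<otimes> y \<otimes> inv x"
proof -
  have "x \<otimes> z \<otimes> y \<otimes> inv (x \<otimes> z) = x \<otimes> (z \<otimes> y) \<otimes> inv z \<otimes> inv x"
    using assms by (simp add: m_assoc inv_mult_group)
  also have "\<dots> = x \<otimes> y \<otimes> inv x"
    using assms by (simp add: center_commute[OF assms(3,2)] m_assoc inv_mult_cancel)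
  finally show ?thesis .
qed

lemma commutator_mult_center:
  assumes x: "x \<in> carrier G" and y: "y \<in> carrier G" and z: "z \<in> center G" and w: "w \<in> center G"
  shows "x \<otimes> z \<otimes> (y \<otimes> w) \<otimes> inv (x \<otimes> z) \<otimes> inv (y \<otimes> w) = x \<otimes> y \<otimes> inv x \<otimes> inv y"
proof -
  have yw: "y \<otimes> w \<in> carrier G"
    using y w by simp
  have "x \<otimes> z \<otimes> (y \<otimes> w) \<otimes> inv (x \<otimes> z) \<otimes> inv (y \<otimes> w) = x \<otimes> (y \<otimes> w) \<otimes> inv x \<otimes> inv (y \<otimes> w)"
    by (simp only: conj_mult_center[OF x yw z])
  also have "\<dots> = x \<otimes> (y \<otimes> w \<otimes> inv x \<otimes> inv (y \<otimes> w))"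
    using x yw by (simp add: m_assoc)
  also have "\<dots> = x \<otimes> (y \<otimes> inv x \<otimes> inv y)"
    using x by (simp only: conj_mult_center[OF y _ w] inv_closed)
  finally show ?thesis
    using x y by (simp add: m_assoc)
qed

lemma generate_center_normal:
  assumes "S \<subseteq> center G"
  shows "generate G S \<lhd> G"
proof (rule normal_generateI)
  fix z g assume zg: "z \<in> S" "g \<in> carrier G"
  then have z: "z \<in> center G"
    using assms by blast
  have "g \<otimes> z \<otimes> inv g = z"
    using z zg(2) by (simp add: m_assoc flip: center_commute[OF z zg(2)])
  then show "g \<otimes> z \<otimes> inv g \<in> S"
    using zg(1) by simp
qed (use assms in auto)

end

context group_hom
begin

lemma hom_eq_on_generate:
  assumes q: "group_hom G H q" and S: "S \<subseteq> carrier G"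
    and eq: "\<And>x. x \<in> S \<Longrightarrow> h x = q x" and g: "g \<in> generate G S"
  shows "h g = q g"
proof -
  interpret q: group_hom G H q by (rule q)
  show ?thesis
    using g
  proof (induction rule: generate.induct)
    case (inv x)
    then show ?case using S eq by auto
  next
    case (eng x y)
    then show ?case using G.generate_in_carrier[OF S] by simp
  qed (simp_all add: eq)
qed

lemma hom_eq_on_derived_if_eq_mod_center:
  assumes q: "group_hom G H q"
    and central: "\<And>g. g \<in> carrier G \<Longrightarrow> inv\<^bsub>H\<^esub> (q g) \<otimes>\<^bsub>H\<^esub> h g \<in> center H"
    and "c \<in> derived G (carrier G)"
  shows "h c = q c"
proof (rule hom_eq_on_generate[OF q])
  interpret q: group_hom G H q by (rule q)
  show "derived_set G (carrier G) \<subseteq> carrier G"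
    by (rule G.derived_set_in_carrier) simp
  show "c \<in> generate G (derived_set G (carrier G))"
    using assms(3) by (simp add: derived_def)
  fix x assume "x \<in> derived_set G (carrier G)"
  then obtain a b where ab: "a \<in> carrier G" "b \<in> carrier G" and x: "x = a \<otimes> b \<otimes> inv a \<otimes> inv b"
    by blast
  define z where "z g = inv\<^bsub>H\<^esub> (q g) \<otimes>\<^bsub>H\<^esub> h g" for g
  have h_eq: "h g = q g \<otimes>\<^bsub>H\<^esub> z g" if "g \<in> carrier G" for g
    using that by (simp add: z_def H.inv_mult_cancel)
  have "z a \<in> center H" "z b \<in> center H"
    using ab central by (simp_all add: z_def)
  then show "h x = q x"
    using ab H.commutator_mult_center[of "q a" "q b" "z a" "z b"] by (simp add: x flip: h_eq)
qed

lemma hom_center: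
  assumes surj: "h ` carrier G = carrier H" and z: "z \<in> center G"
  shows "h z \<in> center H"
proof -
  have "h z \<otimes>\<^bsub>H\<^esub> h g = h g \<otimes>\<^bsub>H\<^esub> h z" if g: "g \<in> carrier G" for g
    using z g center_commute[OF z g] by (simp flip: hom_mult)
  then show ?thesis
    using z by (intro centerI) (auto simp flip: surj)
qed

lemma kernel_Int_derived_subset:
  assumes Z: "Z \<lhd> G" and ker: "kernel G H h \<subseteq> center G"
    and s: "s \<in> hom H (G Mod Z)" and sec: "\<And>y x. y \<in> carrier H \<Longrightarrow> x \<in> s y \<Longrightarrow> h x = y"
  shows "kernel G H h \<inter> derived G (carrier G) \<subseteq> Z"
proof
  interpret Z: normal Z G by (rule Z)
  interpret Q: group "G Mod Z" by (rule Z.factorgroup_is_group)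
  interpret p: group_hom G "G Mod Z" "\<lambda>g. Z #> g"
    by unfold_locales (rule Z.r_coset_hom_Mod)
  interpret s: group_hom H "G Mod Z" s
    by unfold_locales (rule s)
  interpret q: group_hom G "G Mod Z" "s \<circ> h"
    by unfold_locales (rule Group.hom_compose[OF homh s])
  fix g assume g: "g \<in> kernel G H h \<inter> derived G (carrier G)"
  have "Z #> g = (s \<circ> h) g"
  proof (rule p.hom_eq_on_derived_if_eq_mod_center[OF q.group_hom_axioms])
    fix x assume x: "x \<in> carrier G"
    then have "s (h x) \<in> carrier (G Mod Z)" by simp
    then obtain y where y: "y \<in> carrier G" "s (h x) = Z #> y"
      by (auto simp: carrier_FactGroup)
    then have "h y = h x"
      using sec[of "h x" y] x G.rcos_self[OF y(1) Z.subgroup_axioms] by simp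
    then have "inv y \<otimes> x \<in> kernel G H h"
      using x y by (simp add: kernel_def)
    then have "Z #> (inv y \<otimes> x) \<in> center (G Mod Z)"
      using ker by (intro p.hom_center) (auto simp: carrier_FactGroup)
    moreover have "inv\<^bsub>G Mod Z\<^esub> (s (h x)) \<otimes>\<^bsub>G Mod Z\<^esub> (Z #> x) = Z #> (inv y \<otimes> x)"
      using x y by (simp only: p.hom_mult p.hom_inv G.inv_closed)
    ultimately show "inv\<^bsub>G Mod Z\<^esub> ((s \<circ> h) x) \<otimes>\<^bsub>G Mod Z\<^esub> (Z #> x) \<in> center (G Mod Z)"
      by simp
  qed (use g in simp)
  also have "\<dots> = Z"
    using g s.hom_one by (simp add: kernel_def)
  finally show "g \<in> Z"
    using g by (intro G.coset_join1[OF _ _ Z.subgroup_axioms]) (auto simp: kernel_def)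
qed

end

section \<open>Homomorphisms on free Abelian groups\<close>

lemma lookup_hom_free_Abelian_group:
  assumes \<phi>: "\<phi> \<in> hom (free_Abelian_group S) (free_Abelian_group T)"
    and \<phi>_of: "\<And>p. p \<in> S \<Longrightarrow> \<phi> (frag_of p) = frag_cmul (m p) (frag_of (f p))"
    and f: "inj_on f S" and p: "p \<in> S" and n: "Poly_Mapping.keys n \<subseteq> S"
  shows "Poly_Mapping.lookup (\<phi> n) (f p) = m p * Poly_Mapping.lookup n p"
proof -
  interpret \<phi>: group_hom "free_Abelian_group S" "free_Abelian_group T" \<phi>
    using \<phi> by (simp add: group_hom_def group_hom_axioms_def)
  show ?thesis
    using n
  proof (induction n rule: free_Abelian_group_induct[consumes 1, case_names zero diff of])
    case zero
    show ?case using \<phi>.hom_one by simp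
  next
    case (diff x y)
    have "\<phi> (x + - y) = \<phi> x + - \<phi> y"
      using diff \<phi>.hom_mult[of x "- y"] \<phi>.hom_inv[of y] \<phi>.hom_closed[of y] by simp
    then show ?case
      using diff by (simp add: lookup_minus right_diff_distrib)
  next
    case (of q)
    then have "f p = f q \<longleftrightarrow> p = q"
      using f p by (auto dest: inj_onD)
    then show ?case
      using of by (simp add: \<phi>_of)
  qed
qed

lemma inj_on_hom_free_Abelian_group:
  assumes "\<phi> \<in> hom (free_Abelian_group S) (free_Abelian_group T)"
    and "\<And>p. p \<in> S \<Longrightarrow> \<phi> (frag_of p) = frag_cmul (m p) (frag_of (f p))"
    and "inj_on f S" and m: "\<And>p. p \<in> S \<Longrightarrow> m p \<noteq> 0"
  shows "inj_on \<phi> (carrier (free_Abelian_group S))"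
proof (rule inj_onI)
  note coeff = lookup_hom_free_Abelian_group[OF assms(1-3)]
  fix x y assume xy: "x \<in> carrier (free_Abelian_group S)" "y \<in> carrier (free_Abelian_group S)"
    and eq: "\<phi> x = \<phi> y"
  show "x = y"
  proof (rule poly_mapping_eqI)
    fix p
    show "Poly_Mapping.lookup x p = Poly_Mapping.lookup y p"
    proof (cases "p \<in> S")
      case True
      then show ?thesis using coeff[of p x] coeff[of p y] eq xy m[of p] by simp
    next
      case False
      then have "p \<notin> Poly_Mapping.keys x" "p \<notin> Poly_Mapping.keys y"
        using xy by auto
      then show ?thesis by (simp add: in_keys_iff)
    qed
  qed
qed

context group
begin

lemma generate_center_free_Abelian_image:
  assumes t: "t ` P \<subseteq> center G"
  obtains \<tau> where "\<tau> \<in> hom (free_Abelian_group P) G" "\<And>p. p \<in> P \<Longrightarrow> \<tau> (frag_of p) = t p"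
    "generate G (t ` P) = \<tau> ` carrier (free_Abelian_group P)"
proof -
  define Z where "Z = generate G (t ` P)"
  have Z: "subgroup Z G"
    unfolding Z_def using t by (intro generate_is_subgroup) auto
  have central: "Z \<subseteq> center G"
    unfolding Z_def by (rule generate_subgroup_incl[OF t subgroup_center])
  have "x \<otimes> y = y \<otimes> x" if "x \<in> Z" "y \<in> Z" for x y
    using that central by (intro center_commute) auto
  then have "comm_group (G\<lparr>carrier := Z\<rparr>)"
    by (intro group.group_comm_groupI[OF subgroup_imp_group[OF Z]]) simp_all
  moreover have "t ` P \<subseteq> Z"
    unfolding Z_def by (auto intro: generate.incl)
  ultimately obtain \<tau> where \<tau>: "\<tau> \<in> hom (free_Abelian_group P) (G\<lparr>carrier := Z\<rparr>)"
    and \<tau>_of: "\<And>p. p \<in> P \<Longrightarrow> \<tau> (frag_of p) = t p"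
    using comm_group.free_Abelian_group_universal[of "G\<lparr>carrier := Z\<rparr>" t P] by auto
  then have \<tau>G: "\<tau> \<in> hom (free_Abelian_group P) G"
    using subgroup.subset[OF Z] by (auto simp: hom_def Pi_def)
  interpret \<tau>: group_hom "free_Abelian_group P" G \<tau>
    using \<tau>G is_group by (simp add: group_hom_def group_hom_axioms_def)
  have "t ` P \<subseteq> \<tau> ` carrier (free_Abelian_group P)"
  proof (rule image_subsetI)
    fix p assume "p \<in> P"
    then show "t p \<in> \<tau> ` carrier (free_Abelian_group P)"
      using imageI[of "frag_of p" "carrier (free_Abelian_group P)" \<tau>] \<tau>_of by simp
  qed
  then have "Z \<subseteq> \<tau> ` carrier (free_Abelian_group P)"
    unfolding Z_def by (rule generate_subgroup_incl[OF _ \<tau>.img_is_subgroup])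
  moreover have "\<tau> ` carrier (free_Abelian_group P) \<subseteq> Z"
    using hom_carrier[OF \<tau>] by simp
  ultimately show ?thesis
    using that[OF \<tau>G \<tau>_of] by (simp add: Z_def)
qed

lemma inj_on_generate_center_hom_free_Abelian_group:
  assumes \<alpha>: "\<alpha> \<in> hom G (free_Abelian_group T)" and t: "t ` P \<subseteq> center G"
    and \<alpha>t: "\<And>p. p \<in> P \<Longrightarrow> \<alpha> (t p) = frag_cmul (m p) (frag_of (f p))"
    and f: "inj_on f P" and m: "\<And>p. p \<in> P \<Longrightarrow> m p \<noteq> 0"
  shows "inj_on \<alpha> (generate G (t ` P))"
proof -
  obtain \<tau> where \<tau>: "\<tau> \<in> hom (free_Abelian_group P) G" "\<And>p. p \<in> P \<Longrightarrow> \<tau> (frag_of p) = t p"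
    and Z: "generate G (t ` P) = \<tau> ` carrier (free_Abelian_group P)"
    using generate_center_free_Abelian_image[OF t] by blast
  have "inj_on (\<alpha> \<circ> \<tau>) (carrier (free_Abelian_group P))"
    using \<tau>(2) \<alpha>t f m by (intro inj_on_hom_free_Abelian_group[OF Group.hom_compose[OF \<tau>(1) \<alpha>]]) auto
  then show ?thesis
    unfolding Z by (rule inj_on_imageI)
qed

end

section \<open>Words and generators\<close>

lemma (in group) word_eval_in_generate:
  assumes "w \<in> words \<Gamma>"
  shows "word_eval G f w \<in> generate G (f ` \<Gamma>)"
  using assms
proof (induction w)
  case Nil
  show ?case by (simp add: generate.one)
next
  case (Cons p w)
  then have "f (fst p) \<in> f ` \<Gamma>" by simp
  then show ?case
    using Cons by (cases p) (auto intro!: generate.eng intro: generate.incl generate.inv)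
qed

lemma (in group) word_eval_replicate:
  assumes "f x \<in> carrier G"
  shows "word_eval G f (replicate k (x, True)) = f x [^] k"
proof (induction k)
  case (Suc k)
  then show ?case using assms nat_pow_Suc2[of "f x" k] by (simp del: nat_pow_Suc)
qed simp

lemma generate_pres_gen:
  "generate (presented_group \<Gamma> R) (pres_gen \<Gamma> R ` \<Gamma>) = carrier (presented_group \<Gamma> R)"
proof
  interpret group "presented_group \<Gamma> R" by (rule group_presented_group)
  show "generate (presented_group \<Gamma> R) (pres_gen \<Gamma> R ` \<Gamma>) \<subseteq> carrier (presented_group \<Gamma> R)"
    by (rule generate_incl) (auto simp: pres_gen_closed)
  show "carrier (presented_group \<Gamma> R) \<subseteq> generate (presented_group \<Gamma> R) (pres_gen \<Gamma> R ` \<Gamma>)"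
  proof
    fix S assume "S \<in> carrier (presented_group \<Gamma> R)"
    then obtain w where w: "w \<in> words \<Gamma>" and S: "S = pres_cong \<Gamma> R `` {w}"
      by (auto simp: pres_carrier_iff)
    have "S = word_eval (presented_group \<Gamma> R) (pres_gen \<Gamma> R) w"
      using pres_hom_class[of "\<lambda>x. x" \<Gamma> R w] w by (simp add: hom_def S)
    then show "S \<in> generate (presented_group \<Gamma> R) (pres_gen \<Gamma> R ` \<Gamma>)"
      using word_eval_in_generate[OF w] by simp
  qed
qed

lemma (in group) word_eval_pres_hom_cong:
  assumes h: "h \<in> hom (presented_group \<Gamma> R) G"
    and uv: "(u, v) \<in> R" "u \<in> words \<Gamma>" "v \<in> words \<Gamma>"
  shows "word_eval G (\<lambda>x. h (pres_gen \<Gamma> R x)) u = word_eval G (\<lambda>x. h (pres_gen \<Gamma> R x)) v"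
proof -
  have "pres_cong \<Gamma> R `` {u} = pres_cong \<Gamma> R `` {v}"
    using uv by (simp add: pres_class_eq pres_cong.rel)
  then show ?thesis
    using pres_hom_class[OF h] uv(2,3) by metis
qed

section \<open>The structure group\<close>

context group
begin

lemma conj_class_refl:
  assumes "a \<in> carrier G"
  shows "a \<in> conj_class G a"
  unfolding conj_class_def using assms by (rule group_action.orbit_refl[OF action_by_conjugation])

lemma conj_class_eqD:
  assumes "conj_class G a = conj_class G b" "a \<in> carrier G" "b \<in> carrier G"
  obtains y where "y \<in> carrier G" "a = inv y \<otimes> b \<otimes> y"
proof -
  have "a \<in> conj_class G b" using conj_class_refl[OF assms(2)] assms(1) by simp
  then obtain g where "g \<in> carrier G" "a = g \<otimes> b \<otimes> inv g"
    using assms(3) by (auto simp: conj_class_def orbit_def)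
  then show ?thesis using that[of "inv g"] by simp
qed

abbreviation "A \<equiv> structure_group G"

lemma group_structure_group: "group A"
  unfolding structure_group_def by (rule group_presented_group)

lemma structure_gen_closed: "a \<in> carrier G \<Longrightarrow> structure_gen G a \<in> carrier A"
  unfolding structure_group_def structure_gen_def by (rule pres_gen_closed)

lemma generate_structure_gen: "generate A (structure_gen G ` carrier G) = carrier A"
  unfolding structure_group_def structure_gen_def by (rule generate_pres_gen)

lemma structure_gen_rel:
  assumes "a \<in> carrier G" "b \<in> carrier G"
  shows "structure_gen G a \<otimes>\<^bsub>A\<^esub> structure_gen G b
    = structure_gen G b \<otimes>\<^bsub>A\<^esub> structure_gen G (inv b \<otimes> a \<otimes> b)"
proof -
  have "([(a, True), (b, True)], [(b, True), (inv b \<otimes> a \<otimes> b, True)])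
      \<in> pres_cong (carrier G) (quandle_rels G)"
    by (rule pres_cong.rel) (use assms in \<open>auto simp: quandle_rels_def\<close>)
  then show ?thesis
    using assms
    by (simp add: structure_group_def structure_gen_def pres_gen_def pres_mult_class pres_class_eq)
qed

lemma structure_group_hom_eqI:
  assumes "group H" "p \<in> hom A H" "q \<in> hom A H"
    and "\<And>a. a \<in> carrier G \<Longrightarrow> p (structure_gen G a) = q (structure_gen G a)" "g \<in> carrier A"
  shows "p g = q g"
  using group.pres_hom_unique[OF assms(1)] assms(2-) unfolding structure_group_def structure_gen_def
  by metis

lemma group_hom_proj: "group_hom A G (proj_hom G)"
  using group_structure_group proj_hom_hom is_group
  by (simp add: group_hom_def group_hom_axioms_def)

lemma group_hom_ab: "group_hom A (free_Abelian_group (conj_classes G)) (ab_hom G)"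
  using group_structure_group ab_hom_hom
  by (simp add: group_hom_def group_hom_axioms_def)

lemma structure_gen_conj_structure_gen:
  assumes a: "a \<in> carrier G" and b: "b \<in> carrier G"
  shows "structure_gen G b \<otimes>\<^bsub>A\<^esub> structure_gen G a \<otimes>\<^bsub>A\<^esub> inv\<^bsub>A\<^esub> structure_gen G b
      = structure_gen G (b \<otimes> a \<otimes> inv b)"
    and "inv\<^bsub>A\<^esub> structure_gen G b \<otimes>\<^bsub>A\<^esub> structure_gen G a \<otimes>\<^bsub>A\<^esub> structure_gen G b
      = structure_gen G (inv b \<otimes> a \<otimes> b)"
proof -
  interpret A: group A by (rule group_structure_group)
  have "inv b \<otimes> (b \<otimes> a \<otimes> inv b) \<otimes> b = a"
    using a b by (simp add: m_assoc inv_mult_cancel)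
  then have "structure_gen G b \<otimes>\<^bsub>A\<^esub> structure_gen G a
      = structure_gen G (b \<otimes> a \<otimes> inv b) \<otimes>\<^bsub>A\<^esub> structure_gen G b"
    using structure_gen_rel[of "b \<otimes> a \<otimes> inv b" b] a b by simp
  then show "structure_gen G b \<otimes>\<^bsub>A\<^esub> structure_gen G a \<otimes>\<^bsub>A\<^esub> inv\<^bsub>A\<^esub> structure_gen G b
      = structure_gen G (b \<otimes> a \<otimes> inv b)"
    using a b by (simp add: A.inv_solve_right' structure_gen_closed)
  show "inv\<^bsub>A\<^esub> structure_gen G b \<otimes>\<^bsub>A\<^esub> structure_gen G a \<otimes>\<^bsub>A\<^esub> structure_gen G b
      = structure_gen G (inv b \<otimes> a \<otimes> b)"
    using structure_gen_rel[OF a b] a b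
    by (simp add: A.m_assoc A.inv_solve_left' structure_gen_closed)
qed

lemma structure_gen_conj:
  assumes g: "g \<in> carrier A" and a: "a \<in> carrier G"
  shows "g \<otimes>\<^bsub>A\<^esub> structure_gen G a \<otimes>\<^bsub>A\<^esub> inv\<^bsub>A\<^esub> g
    = structure_gen G (proj_hom G g \<otimes> a \<otimes> inv (proj_hom G g))"
proof -
  interpret \<pi>: group_hom A G "proj_hom G" by (rule group_hom_proj)
  let ?e = "structure_gen G"
  have gens: "?e ` carrier G \<subseteq> carrier A"
    using structure_gen_closed by blast
  have "g \<in> generate A (?e ` carrier G)"
    using g by (simp add: generate_structure_gen)
  then show ?thesis
    using a
  proof (induction arbitrary: a rule: generate.induct)
    case one
    then show ?case by (simp add: structure_gen_closed)
  next
    case (incl x)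
    then show ?case
      by (auto simp: structure_gen_conj_structure_gen proj_hom_gen)
  next
    case (inv x)
    then show ?case
      by (auto simp: structure_gen_conj_structure_gen proj_hom_gen structure_gen_closed)
  next
    case (eng x y)
    then have xy: "x \<in> carrier A" "y \<in> carrier A"
      using \<pi>.G.generate_in_carrier[OF gens] by blast+
    have "x \<otimes>\<^bsub>A\<^esub> y \<otimes>\<^bsub>A\<^esub> ?e a \<otimes>\<^bsub>A\<^esub> inv\<^bsub>A\<^esub> (x \<otimes>\<^bsub>A\<^esub> y)
        = x \<otimes>\<^bsub>A\<^esub> (y \<otimes>\<^bsub>A\<^esub> ?e a \<otimes>\<^bsub>A\<^esub> inv\<^bsub>A\<^esub> y) \<otimes>\<^bsub>A\<^esub> inv\<^bsub>A\<^esub> x"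
      using xy eng.prems by (simp add: structure_gen_closed \<pi>.G.m_assoc \<pi>.G.inv_mult_group)
    then show ?case
      using xy eng.prems by (simp add: eng.IH m_assoc inv_mult_group)
  qed
qed

lemma kernel_proj_hom_subset_center: "kernel A G (proj_hom G) \<subseteq> center A"
proof
  interpret \<pi>: group_hom A G "proj_hom G" by (rule group_hom_proj)
  fix k assume "k \<in> kernel A G (proj_hom G)"
  then have k: "k \<in> carrier A" "proj_hom G k = \<one>" by (auto simp: kernel_def)
  define conj where "conj g = k \<otimes>\<^bsub>A\<^esub> g \<otimes>\<^bsub>A\<^esub> inv\<^bsub>A\<^esub> k" for g
  have homs: "conj \<in> hom A A" "(\<lambda>g. g) \<in> hom A A"
    using k(1) by (auto intro!: homI simp: conj_def \<pi>.G.m_assoc \<pi>.G.inv_mult_cancel)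
  have gens: "conj (structure_gen G a) = structure_gen G a" if "a \<in> carrier G" for a
    using structure_gen_conj[OF k(1) that] that by (simp add: conj_def k(2))
  have conj: "conj g = g" if "g \<in> carrier A" for g
    by (rule structure_group_hom_eqI[OF \<pi>.G.is_group homs gens that])
  have "k \<otimes>\<^bsub>A\<^esub> g = g \<otimes>\<^bsub>A\<^esub> k" if "g \<in> carrier A" for g
    using conj[OF that] that k(1) by (simp add: conj_def \<pi>.G.inv_solve_right')
  then show "k \<in> center A"
    using k(1) by (rule centerI[rotated])
qed

lemma comm_hom_structure_gen_eq:
  assumes M: "comm_group M" and \<phi>: "\<phi> \<in> hom A M"
    and a: "a \<in> carrier G" and b: "b \<in> carrier G" and ab: "conj_class G a = conj_class G b"
  shows "\<phi> (structure_gen G a) = \<phi> (structure_gen G b)"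
proof -
  interpret M: comm_group M by (rule M)
  interpret \<phi>: group_hom A M \<phi>
    using group_structure_group M.is_group \<phi> by (simp add: group_hom_def group_hom_axioms_def)
  let ?e = "structure_gen G"
  obtain y where y: "y \<in> carrier G" "a = inv y \<otimes> b \<otimes> y"
    using conj_class_eqD[OF ab a b] .
  have e: "?e a \<in> carrier A" "?e b \<in> carrier A" "?e y \<in> carrier A"
    using a b y(1) by (simp_all add: structure_gen_closed)
  have "\<phi> (?e b) \<otimes>\<^bsub>M\<^esub> \<phi> (?e y) = \<phi> (?e y) \<otimes>\<^bsub>M\<^esub> \<phi> (?e a)"
    using structure_gen_rel[OF b y(1)] e by (simp add: y(2) flip: \<phi>.hom_mult)
  then show ?thesis
    using e by (simp add: M.m_comm[of "\<phi> (?e b)"])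
qed

lemma ab_hom_universal:
  assumes M: "comm_group M" and \<phi>: "\<phi> \<in> hom A M"
  obtains \<theta> where "\<theta> \<in> hom (free_Abelian_group (conj_classes G)) M"
    "\<And>g. g \<in> carrier A \<Longrightarrow> \<phi> g = \<theta> (ab_hom G g)"
proof -
  interpret M: comm_group M by (rule M)
  let ?e = "structure_gen G"
  obtain f where f: "\<And>a. a \<in> carrier G \<Longrightarrow> \<phi> (?e a) = f (conj_class G a)"
    using comm_hom_structure_gen_eq[OF M \<phi>]
      function_factors_left_gen[of "\<lambda>a. a \<in> carrier G" "conj_class G" "\<lambda>a. \<phi> (?e a)"] by blast
  have "f ` conj_classes G \<subseteq> carrier M"
  proof (rule image_subsetI)
    fix \<O> assume "\<O> \<in> conj_classes G"
    then obtain a where a: "a \<in> carrier G" "\<O> = conj_class G a"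
      by (auto simp: conj_classes_def conj_class_def orbits_def)
    then show "f \<O> \<in> carrier M"
      using f[OF a(1)] hom_in_carrier[OF \<phi> structure_gen_closed[OF a(1)]] by simp
  qed
  then obtain \<theta> where \<theta>: "\<theta> \<in> hom (free_Abelian_group (conj_classes G)) M"
    and \<theta>_of: "\<And>\<O>. \<O> \<in> conj_classes G \<Longrightarrow> \<theta> (frag_of \<O>) = f \<O>"
    using M.free_Abelian_group_universal by blast
  have "\<phi> g = (\<theta> \<circ> ab_hom G) g" if "g \<in> carrier A" for g
    by (rule structure_group_hom_eqI[OF M.is_group \<phi> Group.hom_compose[OF ab_hom_hom \<theta>] _ that])
      (simp add: f ab_hom_gen \<theta>_of conj_class_in_conj_classes)
  then show ?thesis
    using that[OF \<theta>] by simp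
qed

lemma kernel_ab_hom_subset_derived:
  "kernel A (free_Abelian_group (conj_classes G)) (ab_hom G) \<subseteq> derived A (carrier A)"
proof
  interpret A: group A by (rule group_structure_group)
  interpret D: normal "derived A (carrier A)" A by (rule A.derived_self_is_normal)
  fix g assume "g \<in> kernel A (free_Abelian_group (conj_classes G)) (ab_hom G)"
  then have g: "g \<in> carrier A" "ab_hom G g = 0" by (auto simp: kernel_def)
  obtain \<theta> where \<theta>: "\<theta> \<in> hom (free_Abelian_group (conj_classes G)) (A Mod derived A (carrier A))"
    and factor: "\<And>x. x \<in> carrier A \<Longrightarrow> derived A (carrier A) #>\<^bsub>A\<^esub> x = \<theta> (ab_hom G x)"
    using ab_hom_universal[OF A.derived_quot_is_comm_group D.r_coset_hom_Mod] by blast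
  have "derived A (carrier A) #>\<^bsub>A\<^esub> g = derived A (carrier A)"
    using factor[OF g(1)] g(2) hom_one[OF \<theta> _ D.factorgroup_is_group] by simp
  then show "g \<in> derived A (carrier A)"
    using g(1) by (rule A.coset_join1[OF _ _ D.subgroup_axioms])
qed

end

section \<open>Groups with a $\overline{C}$-type presentation\<close>

locale Cbar_presented_group = group G for G :: "('a, 'm) monoid_scheme" (structure) +
  fixes \<Gamma> :: "'x set" and C :: "('x \<times> 'x \<times> 'x) set" and P :: "('x \<times> nat) set"
    and h :: "'x word set \<Rightarrow> 'a"
  assumes presentation: "Cbar_presentation G \<Gamma> C P h"
begin

abbreviation "presented \<equiv> presented_group \<Gamma> (Cbar_rels C P)"

definition gen :: "'x \<Rightarrow> 'a"
  where "gen a = h (pres_gen \<Gamma> (Cbar_rels C P) a)"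

lemma conj_rel_gens: "(a, b, c) \<in> C \<Longrightarrow> a \<in> \<Gamma> \<and> b \<in> \<Gamma> \<and> c \<in> \<Gamma>"
  and power_rel_gen: "(a, k) \<in> P \<Longrightarrow> a \<in> \<Gamma>"
  and power_rel_exponent: "(a, k) \<in> P \<Longrightarrow> 2 \<le> k"
  and iso_presented: "h \<in> iso presented G"
  using presentation by (auto simp: Cbar_presentation_def)

lemma hom_presented: "h \<in> hom presented G"
  using iso_presented by (simp add: iso_def)

lemma gen_closed: "a \<in> \<Gamma> \<Longrightarrow> gen a \<in> carrier G"
  unfolding gen_def using hom_presented pres_gen_closed by (rule hom_in_carrier)

lemma word_eval_gen_cong:
  assumes "(u, v) \<in> Cbar_rels C P" "u \<in> words \<Gamma>" "v \<in> words \<Gamma>"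
  shows "word_eval G gen u = word_eval G gen v"
  using word_eval_pres_hom_cong[OF hom_presented assms] by (simp add: gen_def[abs_def])

lemma gen_conj_rel:
  assumes "(a, b, c) \<in> C"
  shows "inv (gen b) \<otimes> gen a \<otimes> gen b = gen c"
proof -
  have "a \<in> \<Gamma>" "b \<in> \<Gamma>" "c \<in> \<Gamma>" using conj_rel_gens[OF assms] by auto
  moreover have "([(b, False), (a, True), (b, True)], [(c, True)]) \<in> Cbar_rels C P"
    using assms by (auto simp: Cbar_rels_def)
  ultimately show ?thesis
    using word_eval_gen_cong[of "[(b, False), (a, True), (b, True)]" "[(c, True)]"]
    by (simp add: gen_closed m_assoc)
qed

lemma gen_power_rel:
  assumes "(a, k) \<in> P"
  shows "gen a [^] k = \<one>"
proof -
  have a: "a \<in> \<Gamma>" by (rule power_rel_gen[OF assms])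
  have "(replicate k (a, True), []) \<in> Cbar_rels C P"
    using assms by (auto simp: Cbar_rels_def)
  moreover have "replicate k (a, True) \<in> words \<Gamma>"
    using a by (induction k) auto
  ultimately show ?thesis
    using word_eval_gen_cong[of "replicate k (a, True)" "[]"] a by (simp add: word_eval_replicate gen_closed)
qed

lemma power_rel_unique:
  assumes "(a, k) \<in> P" "(b, l) \<in> P" "conj_class G (gen a) = conj_class G (gen b)"
  shows "(a, k) = (b, l)"
proof -
  have ab: "gen a \<in> carrier G" "gen b \<in> carrier G"
    using assms(1,2) by (auto intro: gen_closed power_rel_gen)
  then have mem: "gen a \<in> conj_class G (gen a)" "gen b \<in> conj_class G (gen a)"
    using assms(3) conj_class_refl by auto
  have "\<forall>(a, k) \<in> P. \<forall>(b, l) \<in> P. gen a \<in> \<O> \<longrightarrow> gen b \<in> \<O> \<longrightarrow> (a, k) = (b, l)"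
    if "\<O> \<in> conj_classes G" for \<O>
    using presentation that unfolding Cbar_presentation_def gen_def by (elim conjE) (rule bspec)
  from this[OF conj_class_in_conj_classes[OF ab(1)]] show ?thesis
    using assms(1,2) mem by fast
qed

lemma hom_eqI:
  assumes "group H" "p \<in> hom G H" "q \<in> hom G H"
    and "\<And>a. a \<in> \<Gamma> \<Longrightarrow> p (gen a) = q (gen a)" and y: "y \<in> carrier G"
  shows "p y = q y"
proof -
  obtain S where S: "S \<in> carrier presented" "y = h S"
    using iso_presented y by (auto simp: iso_def bij_betw_def)
  have "(p \<circ> h) S = (q \<circ> h) S"
    by (rule group.pres_hom_unique[OF assms(1) Group.hom_compose[OF hom_presented assms(2)]
          Group.hom_compose[OF hom_presented assms(3)] _ S(1)])
      (use assms(4) in \<open>simp add: gen_def\<close>)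
  then show ?thesis
    by (simp add: S(2))
qed

lemma word_eval_cong_Cbar_rels:
  assumes H: "group H" and f: "f \<in> \<Gamma> \<rightarrow> carrier H"
    and conj_rel: "\<And>a b c. (a, b, c) \<in> C \<Longrightarrow> f a \<otimes>\<^bsub>H\<^esub> f b = f b \<otimes>\<^bsub>H\<^esub> f c"
    and power_rel: "\<And>a k. (a, k) \<in> P \<Longrightarrow> f a [^]\<^bsub>H\<^esub> k = \<one>\<^bsub>H\<^esub>"
    and uv: "(u, v) \<in> Cbar_rels C P"
  shows "word_eval H f u = word_eval H f v"
proof -
  interpret H: group H by (rule H)
  consider (conj) a b c where "(a, b, c) \<in> C" "u = [(b, False), (a, True), (b, True)]" "v = [(c, True)]"
    | (power) a k where "(a, k) \<in> P" "u = replicate k (a, True)" "v = []"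
    using uv by (auto simp: Cbar_rels_def)
  then show ?thesis
  proof cases
    case conj
    then have "f a \<in> carrier H" "f b \<in> carrier H" "f c \<in> carrier H"
      using conj_rel_gens f by blast+
    then show ?thesis
      using conj conj_rel by (simp add: H.inv_mult_cancel)
  next
    case power
    then have "f a \<in> carrier H" using power_rel_gen f by blast
    then show ?thesis using power power_rel by (simp add: H.word_eval_replicate)
  qed
qed

lemma hom_extension:
  assumes H: "group H" and f: "f \<in> \<Gamma> \<rightarrow> carrier H"
    and "\<And>a b c. (a, b, c) \<in> C \<Longrightarrow> f a \<otimes>\<^bsub>H\<^esub> f b = f b \<otimes>\<^bsub>H\<^esub> f c"
    and "\<And>a k. (a, k) \<in> P \<Longrightarrow> f a [^]\<^bsub>H\<^esub> k = \<one>\<^bsub>H\<^esub>"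
  obtains s where "s \<in> hom G H" "\<And>a. a \<in> \<Gamma> \<Longrightarrow> s (gen a) = f a"
proof -
  note respects = word_eval_cong_Cbar_rels[OF assms]
  define s where "s = pres_lift H f \<circ> inv_into (carrier presented) h"
  have "inv_into (carrier presented) h \<in> hom G presented"
    using group.iso_set_sym[OF group_presented_group iso_presented] by (simp add: iso_def)
  then have "s \<in> hom G H"
    unfolding s_def using group.pres_lift_hom[OF H f respects] by (rule Group.hom_compose)
  moreover have "s (gen a) = f a" if "a \<in> \<Gamma>" for a
  proof -
    have "inv_into (carrier presented) h (gen a) = pres_gen \<Gamma> (Cbar_rels C P) a"
      using iso_presented pres_gen_closed[OF that]
      unfolding gen_def by (intro inv_into_f_f) (auto simp: iso_def bij_betw_def)
    then show ?thesis
      using group.pres_lift_gen[OF H f respects that] by (simp add: s_def)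
  qed
  ultimately show ?thesis by (rule that)
qed

sublocale \<pi>: group_hom "structure_group G" G "proj_hom G"
  by (rule group_hom_proj)

definition power_elem :: "'x \<times> nat \<Rightarrow> 'a word set"
  where "power_elem p = structure_gen G (gen (fst p)) [^]\<^bsub>A\<^esub> snd p"

definition power_subgroup :: "'a word set set"
  where "power_subgroup = generate A (power_elem ` P)"

lemma power_elem_image_subset_kernel: "power_elem ` P \<subseteq> kernel A G (proj_hom G)"
  by (auto simp: kernel_def power_elem_def \<pi>.hom_nat_pow structure_gen_closed gen_closed
    power_rel_gen proj_hom_gen gen_power_rel)

lemma power_elem_image_subset_center: "power_elem ` P \<subseteq> center A"
  using power_elem_image_subset_kernel kernel_proj_hom_subset_center by blast

lemma power_subgroup_normal: "power_subgroup \<lhd> A"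
  unfolding power_subgroup_def by (rule \<pi>.G.generate_center_normal[OF power_elem_image_subset_center])

lemma power_subgroup_subset_kernel: "power_subgroup \<subseteq> kernel A G (proj_hom G)"
  unfolding power_subgroup_def
  by (rule \<pi>.G.generate_subgroup_incl[OF power_elem_image_subset_kernel \<pi>.subgroup_kernel])

lemma inj_on_ab_hom_power_subgroup: "inj_on (ab_hom G) power_subgroup"
  unfolding power_subgroup_def
proof (rule \<pi>.G.inj_on_generate_center_hom_free_Abelian_group[OF ab_hom_hom power_elem_image_subset_center])
  interpret ab: group_hom A "free_Abelian_group (conj_classes G)" "ab_hom G" by (rule group_hom_ab)
  show "ab_hom G (power_elem p) = frag_cmul (int (snd p)) (frag_of (conj_class G (gen (fst p))))"
    if "p \<in> P" for p
  proof -
    have "gen (fst p) \<in> carrier G"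
      using that power_rel_gen[of "fst p" "snd p"] by (simp add: gen_closed)
    then show ?thesis
      by (simp add: power_elem_def ab.hom_nat_pow structure_gen_closed ab_hom_gen)
  qed
  show "inj_on (\<lambda>p. conj_class G (gen (fst p))) P"
    using power_rel_unique by (force intro: inj_onI)
  show "int (snd p) \<noteq> 0" if "p \<in> P" for p
    using that power_rel_exponent[of "fst p" "snd p"] by simp
qed

lemma coset_hom_extension:
  obtains s where "s \<in> hom G (A Mod power_subgroup)"
    "\<And>a. a \<in> \<Gamma> \<Longrightarrow> s (gen a) = power_subgroup #>\<^bsub>A\<^esub> structure_gen G (gen a)"
proof -
  let ?Z = power_subgroup
  interpret Z: normal ?Z A by (rule power_subgroup_normal)
  interpret p: group_hom A "A Mod ?Z" "\<lambda>g. ?Z #>\<^bsub>A\<^esub> g"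
    using Z.factorgroup_is_group Z.r_coset_hom_Mod \<pi>.G.is_group
    by (simp add: group_hom_def group_hom_axioms_def)
  define f where "f a = ?Z #>\<^bsub>A\<^esub> structure_gen G (gen a)" for a
  have e_closed: "structure_gen G (gen a) \<in> carrier A" if "a \<in> \<Gamma>" for a
    using that by (simp add: gen_closed structure_gen_closed)
  have f: "f \<in> \<Gamma> \<rightarrow> carrier (A Mod ?Z)"
    unfolding f_def using e_closed p.hom_closed by blast
  have conj: "f a \<otimes>\<^bsub>A Mod ?Z\<^esub> f b = f b \<otimes>\<^bsub>A Mod ?Z\<^esub> f c" if "(a, b, c) \<in> C" for a b c
    using conj_rel_gens[OF that] structure_gen_rel[of "gen a" "gen b"]
    by (simp add: f_def e_closed gen_closed gen_conj_rel[OF that] del: mult_FactGroup flip: p.hom_mult)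
  have power: "f a [^]\<^bsub>A Mod ?Z\<^esub> k = \<one>\<^bsub>A Mod ?Z\<^esub>" if "(a, k) \<in> P" for a k
  proof -
    have "power_elem (a, k) \<in> ?Z"
      unfolding power_subgroup_def using that by (intro generate.incl imageI)
    then have "?Z #>\<^bsub>A\<^esub> power_elem (a, k) = ?Z"
      using Z.subgroup_axioms by (intro \<pi>.G.coset_join2) auto
    then show ?thesis
      using e_closed[OF power_rel_gen[OF that]] by (simp add: f_def Z.FactGroup_pow power_elem_def)
  qed
  show ?thesis
    using hom_extension[OF p.H.is_group f conj power] that unfolding f_def by blast
qed

lemma proj_hom_coset_hom:
  assumes s: "s \<in> hom G (A Mod power_subgroup)"
    and s_gen: "\<And>a. a \<in> \<Gamma> \<Longrightarrow> s (gen a) = power_subgroup #>\<^bsub>A\<^esub> structure_gen G (gen a)"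
    and y: "y \<in> carrier G" and g: "g \<in> s y"
  shows "proj_hom G g = y"
proof -
  let ?Z = power_subgroup
  interpret Z: normal ?Z A by (rule power_subgroup_normal)
  have proj_coset: "proj_hom G x = proj_hom G z" if "x \<in> ?Z #>\<^bsub>A\<^esub> z" "z \<in> carrier A" for x z
    using that power_subgroup_subset_kernel by (auto simp: r_coset_def kernel_def)
  obtain \<pi>' where \<pi>': "\<pi>' \<in> hom (A Mod ?Z) G"
    and \<pi>'_coset: "\<And>x. x \<in> carrier A \<Longrightarrow> \<pi>' (?Z #>\<^bsub>A\<^esub> x) = proj_hom G x"
    using FactGroup_universal[OF proj_hom_hom power_subgroup_normal] proj_coset
      \<pi>.G.rcos_self[OF _ Z.subgroup_axioms] by (metis (no_types, lifting))
  have "(\<lambda>y. y) \<in> hom G G"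
    by (simp add: hom_def)
  then have "(\<pi>' \<circ> s) y = y"
    by (rule hom_eqI[OF is_group Group.hom_compose[OF s \<pi>'] _ _ y])
      (simp add: s_gen \<pi>'_coset proj_hom_gen gen_closed structure_gen_closed)
  moreover obtain x where "x \<in> carrier A" "s y = ?Z #>\<^bsub>A\<^esub> x"
    using hom_in_carrier[OF s y] by (auto simp: carrier_FactGroup)
  ultimately show ?thesis
    using proj_coset g \<pi>'_coset by simp
qed

lemma kernel_proj_Int_kernel_ab:
  "kernel A G (proj_hom G) \<inter> kernel A (free_Abelian_group (conj_classes G)) (ab_hom G) = {\<one>\<^bsub>A\<^esub>}"
proof (intro equalityI subsetI)
  interpret ab: group_hom A "free_Abelian_group (conj_classes G)" "ab_hom G" by (rule group_hom_ab)
  fix g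
  assume "g \<in> kernel A G (proj_hom G) \<inter> kernel A (free_Abelian_group (conj_classes G)) (ab_hom G)"
  then have g: "g \<in> kernel A G (proj_hom G)" "g \<in> derived A (carrier A)" "ab_hom G g = 0"
    using kernel_ab_hom_subset_derived by (auto simp: kernel_def)
  obtain s where "s \<in> hom G (A Mod power_subgroup)"
    "\<And>a. a \<in> \<Gamma> \<Longrightarrow> s (gen a) = power_subgroup #>\<^bsub>A\<^esub> structure_gen G (gen a)"
    using coset_hom_extension by blast
  note s = this(1) proj_hom_coset_hom[OF this]
  have "g \<in> power_subgroup"
    using \<pi>.kernel_Int_derived_subset[OF power_subgroup_normal kernel_proj_hom_subset_center s] g(1,2)
    by blast
  moreover have "\<one>\<^bsub>A\<^esub> \<in> power_subgroup"
    unfolding power_subgroup_def by (rule generate.one)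
  ultimately show "g \<in> {\<one>\<^bsub>A\<^esub>}"
    using inj_onD[OF inj_on_ab_hom_power_subgroup] g(3) ab.hom_one by simp
qed (use \<pi>.hom_one group_hom.hom_one[OF group_hom_ab] in \<open>simp add: kernel_def\<close>)

end

theorem theorem1:
  fixes G :: "('a, 'm) monoid_scheme"
  assumes "Cbar_group TYPE('x) G"
  shows "(\<lambda>g. (proj_hom G g, ab_hom G g))
    \<in> mon (structure_group G) (G \<times>\<times> free_Abelian_group (conj_classes G))"
proof -
  obtain \<Gamma> :: "'x set" and C P h where "group G" "Cbar_presentation G \<Gamma> C P h"
    using assms by (auto simp: Cbar_group_def)
  then interpret Cbar_presented_group G \<Gamma> C P h
    by (intro Cbar_presented_group.intro Cbar_presented_group_axioms.intro)
  have "(\<lambda>g. (proj_hom G g, ab_hom G g))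
      \<in> hom (structure_group G) (G \<times>\<times> free_Abelian_group (conj_classes G))"
    using proj_hom_hom ab_hom_hom by (simp add: hom_paired)
  moreover have "g = \<one>\<^bsub>structure_group G\<^esub>"
    if "g \<in> carrier (structure_group G)" "proj_hom G g = \<one>\<^bsub>G\<^esub>" "ab_hom G g = 0" for g
    using that kernel_proj_Int_kernel_ab by (auto simp: kernel_def)
  ultimately show ?thesis
    using group_structure_group DirProd_group[OF is_group group_free_Abelian_group]
    by (subst mon_iff_hom_one) auto
qed

end
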